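(* Let $G$ be a connected, locally finite metric graph. Then $G$ is $\delta$-hyperbolic for some $\delta\ge 0$ if and only if there exist constants $\varepsilon>0$ and $k,m\ge 0$ such that $G$ is $\varepsilon$-densely $(k,m)$-path-chordal on the triangles.
   Context: A metric graph is a graph $G$ in which every edge $e$ is regarded as isometric to an interval $[0,l_e]$ (no restriction on the lengths); interior points of edges are points of $G$, and $d(x,y)$ is the length of a shortest path joining $x,y$. A geodesic triangle $T$ is a union of three geodesics $[x_1x_2],[x_2x_3],[x_3x_1]$; it is $\delta$-thin if each side lies in the $\delta$-neighborhood of the union of the other two; $G$ is $\delta$-hyperbolic if every geodesic triangle is $\delta$-thin. For a geodesic triangle $T$, $L(T)$ is its length and $d_T$ is the length (intrinsic path) metric on $T$. A shortcut in $T$ is a path $\sigma$ in $G$ joining two points $p,q$ of $T$ with $L(\sigma)<d_T(p,q)$; $p,q$ are called the shortcut vertices associated to $\sigma$. A subset $A$ of a metric space $X$ is $\varepsilon$-dense if every $x\in X$ has some $a\in A$ with $d(a,x)<\varepsilon$. $G$ is $\varepsilon$-densely $(k,m)$-path-chordal on the triangles if for every geodesic triangle $T$ with $L(T)\ge k$ there exist shortcuts $\sigma_1,\dots,\sigma_r$ in $T$ with $L(\sigma_i)\le m$ whose associated shortcut vertices form an $\varepsilon$-dense subset of $(T,d_T)$.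
   Formalization: T is read as the closed curve traced by its three sides: L(T) is the sum of the side lengths, d_T the length of the shorter arc, and shortcut vertices are parameters of that curve; with the intrinsic metric of the union of the sides, the claim fails for the real line. *)

theory Defs
  imports Complex_Main "Graph_Theory.Digraph_Component"
begin

text \<open>
  The underlying graph is a \<^typ>\<open>('v, 'e) pre_digraph\<close>, so loops and multiple edges are allowed.
  The direction of an arc only fixes the end at which its parametrisation by
  \<open>[0, l e]\<close> starts; paths may traverse arcs in both directions.
\<close>

datatype ('v, 'e) gpoint = Vertex 'v | Inner 'e real

definition metric_graph :: "('v, 'e) pre_digraph \<Rightarrow> ('e \<Rightarrow> real) \<Rightarrow> bool" where
  "metric_graph G l \<longleftrightarrow> wf_digraph G \<and> (\<forall>e\<in>arcs G. 0 < l e)"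

definition locally_finite :: "('v, 'e) pre_digraph \<Rightarrow> bool" where
  "locally_finite G \<longleftrightarrow> (\<forall>v\<in>verts G. finite (in_arcs G v \<union> out_arcs G v))"

definition points :: "('v, 'e) pre_digraph \<Rightarrow> ('e \<Rightarrow> real) \<Rightarrow> ('v, 'e) gpoint set" where
  "points G l = Vertex ` verts G \<union> {Inner e t | e t. e \<in> arcs G \<and> 0 < t \<and> t < l e}"

definition edge_point ::
  "('v, 'e) pre_digraph \<Rightarrow> ('e \<Rightarrow> real) \<Rightarrow> 'e \<Rightarrow> real \<Rightarrow> ('v, 'e) gpoint" where
  "edge_point G l e t =
     (if t = 0 then Vertex (tail G e) else if t = l e then Vertex (head G e) else Inner e t)"

text \<open>
  A path is a finite concatenation of segments \<open>(e, s, t)\<close>, each running along the edge \<open>e\<close>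
  from parameter \<open>s\<close> to parameter \<open>t\<close>.
\<close>

type_synonym 'e gpath = "('e \<times> real \<times> real) list"

fun joins ::
  "('v, 'e) pre_digraph \<Rightarrow> ('e \<Rightarrow> real) \<Rightarrow> ('v, 'e) gpoint \<Rightarrow> 'e gpath \<Rightarrow> ('v, 'e) gpoint \<Rightarrow> bool"
where
  "joins G l x [] y \<longleftrightarrow> x \<in> points G l \<and> x = y"
| "joins G l x ((e, s, t) # \<sigma>) y \<longleftrightarrow>
     e \<in> arcs G \<and> s \<in> {0..l e} \<and> t \<in> {0..l e} \<and> x = edge_point G l e s \<and>
     joins G l (edge_point G l e t) \<sigma> y"

definition path_length :: "'e gpath \<Rightarrow> real" where
  "path_length \<sigma> = (\<Sum>(e, s, t)\<leftarrow>\<sigma>. \<bar>t - s\<bar>)"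

text \<open>
  The infimum is the length of a shortest path whenever there is one; with arbitrarily short edges
  it need not be attained.
\<close>

definition graph_dist ::
  "('v, 'e) pre_digraph \<Rightarrow> ('e \<Rightarrow> real) \<Rightarrow> ('v, 'e) gpoint \<Rightarrow> ('v, 'e) gpoint \<Rightarrow> real" where
  "graph_dist G l x y = Inf {path_length \<sigma> | \<sigma>. joins G l x \<sigma> y}"

definition geodesic_on ::
  "'a set \<Rightarrow> ('a \<Rightarrow> 'a \<Rightarrow> real) \<Rightarrow> (real \<Rightarrow> 'a) \<Rightarrow> real \<Rightarrow> real \<Rightarrow> bool" where
  "geodesic_on M d c u v \<longleftrightarrow>
     u \<le> v \<and> c ` {u..v} \<subseteq> M \<and> (\<forall>s\<in>{u..v}. \<forall>t\<in>{u..v}. d (c s) (c t) = \<bar>s - t\<bar>)"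

text \<open>
  A geodesic triangle of length \<open>L\<close> is traversed by the closed curve \<open>c\<close> on \<open>[0, L]\<close>, whose
  restrictions to \<open>[0, a]\<close>, \<open>[a, b]\<close> and \<open>[b, L]\<close> are the three sides.
\<close>

definition geodesic_triangle ::
  "'a set \<Rightarrow> ('a \<Rightarrow> 'a \<Rightarrow> real) \<Rightarrow> (real \<Rightarrow> 'a) \<Rightarrow> real \<Rightarrow> real \<Rightarrow> real \<Rightarrow> bool" where
  "geodesic_triangle M d c a b L \<longleftrightarrow>
     geodesic_on M d c 0 a \<and> geodesic_on M d c a b \<and> geodesic_on M d c b L \<and> c L = c 0"

definition in_nbhd :: "('a \<Rightarrow> 'a \<Rightarrow> real) \<Rightarrow> real \<Rightarrow> 'a set \<Rightarrow> 'a set \<Rightarrow> bool" where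
  "in_nbhd d \<delta> A B \<longleftrightarrow> (\<forall>p\<in>A. \<exists>q\<in>B. d p q \<le> \<delta>)"

definition thin ::
  "('a \<Rightarrow> 'a \<Rightarrow> real) \<Rightarrow> real \<Rightarrow> (real \<Rightarrow> 'a) \<Rightarrow> real \<Rightarrow> real \<Rightarrow> real \<Rightarrow> bool" where
  "thin d \<delta> c a b L \<longleftrightarrow>
     in_nbhd d \<delta> (c ` {0..a}) (c ` {a..b} \<union> c ` {b..L}) \<and>
     in_nbhd d \<delta> (c ` {a..b}) (c ` {b..L} \<union> c ` {0..a}) \<and>
     in_nbhd d \<delta> (c ` {b..L}) (c ` {0..a} \<union> c ` {a..b})"

definition hyperbolic :: "'a set \<Rightarrow> ('a \<Rightarrow> 'a \<Rightarrow> real) \<Rightarrow> real \<Rightarrow> bool" where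
  "hyperbolic M d \<delta> \<longleftrightarrow> (\<forall>c a b L. geodesic_triangle M d c a b L \<longrightarrow> thin d \<delta> c a b L)"

text \<open>
  The metric \<open>d_T\<close> is the length metric of the triangle as a closed curve of length \<open>L\<close>: the points
  of \<open>T\<close> are named by parameters in \<open>[0, L]\<close> and their distance is the length of the shorter of the
  two arcs of \<open>T\<close> between them. If \<open>c\<close> is simple this is the intrinsic metric of the set
  \<open>c ` {0..L}\<close>. For triangles whose sides overlap, the intrinsic metric of the set would be the
  wrong notion: in a tree it agrees with the ambient metric, so no triangle in a tree would have a
  shortcut, although trees are 0-hyperbolic.
\<close>

definition triangle_dist :: "real \<Rightarrow> real \<Rightarrow> real \<Rightarrow> real" where
  "triangle_dist L s t = min \<bar>s - t\<bar> (L - \<bar>s - t\<bar>)"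

definition eps_dense :: "'a set \<Rightarrow> ('a \<Rightarrow> 'a \<Rightarrow> real) \<Rightarrow> real \<Rightarrow> 'a set \<Rightarrow> bool" where
  "eps_dense X d \<epsilon> A \<longleftrightarrow> A \<subseteq> X \<and> (\<forall>x\<in>X. \<exists>a\<in>A. d a x < \<epsilon>)"

definition shortcut ::
  "('v, 'e) pre_digraph \<Rightarrow> ('e \<Rightarrow> real) \<Rightarrow> (real \<Rightarrow> ('v, 'e) gpoint) \<Rightarrow> real \<Rightarrow>
   real \<Rightarrow> 'e gpath \<Rightarrow> real \<Rightarrow> bool" where
  "shortcut G l c L p \<sigma> q \<longleftrightarrow>
     p \<in> {0..L} \<and> q \<in> {0..L} \<and> joins G l (c p) \<sigma> (c q) \<and> path_length \<sigma> < triangle_dist L p q"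

definition densely_path_chordal_on_triangles ::
  "('v, 'e) pre_digraph \<Rightarrow> ('e \<Rightarrow> real) \<Rightarrow> real \<Rightarrow> real \<Rightarrow> real \<Rightarrow> bool" where
  "densely_path_chordal_on_triangles G l \<epsilon> k m \<longleftrightarrow>
     (\<forall>c a b L. geodesic_triangle (points G l) (graph_dist G l) c a b L \<and> k \<le> L \<longrightarrow>
        (\<exists>S. finite S \<and>
             (\<forall>(p, \<sigma>, q)\<in>S. shortcut G l c L p \<sigma> q \<and> path_length \<sigma> \<le> m) \<and>
             eps_dense {0..L} (triangle_dist L) \<epsilon> (\<Union>(p, \<sigma>, q)\<in>S. {p, q})))"

end

theory Submission
  imports Defs
begin

text \<open>
  Two points of the same side of a geodesic triangle admit no shortcut, because the side already
  realises their distance. Hence a shortcut starting near a point \<open>p\<close> of the triangle leads from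
  the side of \<open>p\<close> to one of the other two, so dense shortcuts of bounded length make triangles
  thin.

  Conversely, let \<open>R = \<delta> + 1\<close>. A point at distance at least \<open>R\<close> from both ends of its side is
  \<open>\<delta>\<close>-close in the graph to a point of another side, whereas the two are at distance at least
  \<open>R\<close> in the triangle: this is a shortcut. In a triangle of length at least \<open>6 * R\<close> such points
  can be reached from everywhere within \<open>3 * R\<close>.
\<close>

subsection \<open>Paths and distance\<close>

lemma edge_point_in_points:
  assumes "metric_graph G l" "e \<in> arcs G" "t \<in> {0..l e}"
  shows "edge_point G l e t \<in> points G l"
  using assms unfolding metric_graph_def edge_point_def points_def
  by (auto simp: wf_digraph_def)

lemma edge_point_0: "edge_point G l e 0 = Vertex (tail G e)"
  by (simp add: edge_point_def)

lemma edge_point_length: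
  assumes "metric_graph G l" "e \<in> arcs G"
  shows "edge_point G l e (l e) = Vertex (head G e)"
  using assms by (auto simp: edge_point_def metric_graph_def)

lemma path_length_Nil [simp]: "path_length [] = 0"
  by (simp add: path_length_def)

lemma path_length_Cons [simp]: "path_length ((e, s, t) # \<sigma>) = \<bar>t - s\<bar> + path_length \<sigma>"
  by (simp add: path_length_def)

lemma path_length_append [simp]: "path_length (\<sigma> @ \<tau>) = path_length \<sigma> + path_length \<tau>"
  by (simp add: path_length_def)

lemma path_length_nonneg: "0 \<le> path_length \<sigma>"
  by (induction \<sigma>) auto

lemma joins_append:
  assumes "joins G l x \<sigma> y" "joins G l y \<tau> z"
  shows "joins G l x (\<sigma> @ \<tau>) z"
  using assms by (induction G l x \<sigma> y rule: joins.induct) auto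

text \<open>Reverse the order of the segments and swap the two parameters within each of them;
  directions of arcs do not restrict paths.\<close>

lemma joins_reverse:
  assumes "metric_graph G l" "joins G l x \<sigma> y"
  shows "\<exists>\<tau>. joins G l y \<tau> x \<and> path_length \<tau> = path_length \<sigma>"
  using assms(2,1)
proof (induction G l x \<sigma> y rule: joins.induct)
  case (1 G l x y)
  then show ?case by (intro exI[of _ "[]"]) auto
next
  case (2 G l x e s t \<sigma> y)
  then obtain \<tau> where \<tau>: "joins G l y \<tau> (edge_point G l e t)" "path_length \<tau> = path_length \<sigma>"
    by auto
  have "joins G l (edge_point G l e t) [(e, t, s)] x"
    using 2 by (auto intro: edge_point_in_points)
  from joins_append[OF \<tau>(1) this] \<tau>(2) show ?case
    by (intro exI[of _ "\<tau> @ [(e, t, s)]"]) auto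
qed

text \<open>An inner point slides along its edge to the tail. This reduces joining arbitrary points
  to joining vertices.\<close>

lemma points_joins_vertex:
  assumes "metric_graph G l" "x \<in> points G l"
  shows "\<exists>v\<in>verts G. \<exists>\<sigma>. joins G l x \<sigma> (Vertex v)"
proof (cases x)
  case (Vertex v)
  then show ?thesis using assms
    by (intro bexI[of _ v] exI[of _ "[]"]) (auto simp: points_def)
next
  case (Inner e t)
  then have e: "e \<in> arcs G" "0 < t" "t < l e" using assms by (auto simp: points_def)
  then have "tail G e \<in> verts G" using assms by (auto simp: metric_graph_def wf_digraph_def)
  moreover from this have "joins G l x [(e, t, 0)] (Vertex (tail G e))"
    using e Inner by (simp add: edge_point_0, simp add: edge_point_def points_def)
  ultimately show ?thesis by blast
qed

lemma vertices_joined: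
  assumes mg: "metric_graph G l" and con: "Digraph_Component.connected G"
    and u: "u \<in> verts G" and v: "v \<in> verts G"
  shows "\<exists>\<sigma>. joins G l (Vertex u) \<sigma> (Vertex v)"
proof -
  \<comment> \<open>Connectedness of a digraph is strong connectedness of its symmetric closure, so
    the walk may use each arc backwards; the induction turns every step of it into one full segment,
    run from \<open>0\<close> to \<open>l e\<close> or from \<open>l e\<close> to
    \<open>0\<close>.\<close>
  have "u \<rightarrow>\<^sup>*\<^bsub>with_proj (mk_symmetric G)\<^esub> v"
    using con u v by (auto simp: connected_def strongly_connected_def)
  then have "(u, v) \<in> rtrancl_on (verts G) (parcs (mk_symmetric G))"
    by (simp add: reachable_def)
  then show ?thesis
  proof (induction rule: rtrancl_on_induct)
    case base
    show ?case using u by (intro exI[of _ "[]"]) (auto simp: points_def)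
  next
    case (step y z)
    then obtain \<sigma> where \<sigma>: "joins G l (Vertex u) \<sigma> (Vertex y)" by blast
    from step obtain e where e: "e \<in> arcs G"
      and ends: "(y, z) = (tail G e, head G e) \<or> (y, z) = (head G e, tail G e)"
      by (auto simp: parcs_mk_symmetric)
    have l: "0 < l e" using mg e by (auto simp: metric_graph_def)
    have "tail G e \<in> verts G" "head G e \<in> verts G"
      using mg e by (auto simp: metric_graph_def wf_digraph_def)
    with ends e l have "joins G l (Vertex y) [(e, 0, l e)] (Vertex z) \<or>
        joins G l (Vertex y) [(e, l e, 0)] (Vertex z)"
      using edge_point_length[OF mg e] by (auto simp: edge_point_0 points_def)
    with \<sigma> show ?case by (blast intro: joins_append)
  qed
qed

lemma points_joined:
  assumes "metric_graph G l" "Digraph_Component.connected G"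
    and "x \<in> points G l" "y \<in> points G l"
  shows "\<exists>\<sigma>. joins G l x \<sigma> y"
proof -
  obtain u \<sigma> where "u \<in> verts G" "joins G l x \<sigma> (Vertex u)"
    using points_joins_vertex assms by blast
  moreover obtain v \<tau> where "v \<in> verts G" "joins G l (Vertex v) \<tau> y"
    using points_joins_vertex joins_reverse assms by metis
  ultimately show ?thesis
    using vertices_joined[OF assms(1,2)] by (blast intro: joins_append)
qed

section \<open>The path distance as an infimum\<close>

lemma graph_dist_le_path_length:
  assumes "joins G l x \<sigma> y"
  shows "graph_dist G l x y \<le> path_length \<sigma>"
  unfolding graph_dist_def
  by (rule cInf_lower) (use assms path_length_nonneg in \<open>auto intro!: bdd_belowI[of _ 0]\<close>)

text \<open>The infimum need not be attained, so a path is obtained only below a strict upper bound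
  \<open>r\<close>. Connectedness keeps the set of path lengths nonempty.\<close>

lemma graph_dist_less_path:
  assumes "metric_graph G l" "Digraph_Component.connected G"
    and "x \<in> points G l" "y \<in> points G l" "graph_dist G l x y < r"
  shows "\<exists>\<sigma>. joins G l x \<sigma> y \<and> path_length \<sigma> < r"
proof -
  have "{path_length \<sigma> | \<sigma>. joins G l x \<sigma> y} \<noteq> {}"
    using points_joined[OF assms(1-4)] by auto
  from cInf_lessD[OF this] assms(5) show ?thesis
    unfolding graph_dist_def by auto
qed

lemma graph_dist_triangle:
  assumes "metric_graph G l" "Digraph_Component.connected G"
    and "x \<in> points G l" "y \<in> points G l" "z \<in> points G l"
  shows "graph_dist G l x z \<le> graph_dist G l x y + graph_dist G l y z"
\<comment> \<open>Shortest paths may be missing, so nearly shortest ones are concatenated, each with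
  slack \<open>r / 2\<close>.\<close>
proof (rule field_le_epsilon)
  fix r :: real assume "0 < r"
  then obtain \<sigma> \<tau> where \<sigma>: "joins G l x \<sigma> y" "path_length \<sigma> < graph_dist G l x y + r / 2"
    and \<tau>: "joins G l y \<tau> z" "path_length \<tau> < graph_dist G l y z + r / 2"
    using graph_dist_less_path[OF assms(1,2,3,4)] graph_dist_less_path[OF assms(1,2,4,5)]
    by (meson less_add_same_cancel1 half_gt_zero)
  from graph_dist_le_path_length[OF joins_append[OF \<sigma>(1) \<tau>(1)]] \<sigma>(2) \<tau>(2)
  show "graph_dist G l x z \<le> graph_dist G l x y + graph_dist G l y z + r" by simp
qed

lemma graph_dist_commute:
  assumes "metric_graph G l"
  shows "graph_dist G l x y = graph_dist G l y x"
proof -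
  have "{path_length \<sigma> | \<sigma>. joins G l x \<sigma> y} = {path_length \<sigma> | \<sigma>. joins G l y \<sigma> x}"
    using joins_reverse[OF assms] by (auto, metis+)
  then show ?thesis by (simp add: graph_dist_def)
qed

subsection \<open>Geodesic triangles\<close>

lemma triangle_dist_commute: "triangle_dist L s t = triangle_dist L t s"
  by (simp add: triangle_dist_def abs_minus_commute)

lemma geodesic_triangle_bounds:
  assumes "geodesic_triangle M d c a b L"
  shows "0 \<le> a" "a \<le> b" "b \<le> L"
  using assms by (auto simp: geodesic_triangle_def geodesic_on_def)

lemma geodesic_triangle_in_carrier:
  assumes "geodesic_triangle M d c a b L" "t \<in> {0..L}"
  shows "c t \<in> M"
proof -
  have "t \<in> {0..a} \<or> t \<in> {a..b} \<or> t \<in> {b..L}" using assms(2) by auto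
  then show ?thesis
    using assms(1) by (auto simp: geodesic_triangle_def geodesic_on_def image_subset_iff)
qed

lemma geodesic_triangle_side:
  assumes "geodesic_triangle M d c a b L" "(u, v) \<in> {(0, a), (a, b), (b, L)}"
  shows "geodesic_on M d c u v" "0 \<le> u" "u \<le> v" "v \<le> L"
  using assms geodesic_triangle_bounds[OF assms(1)] by (auto simp: geodesic_triangle_def)

text \<open>The curve \<open>c\<close> is 1-Lipschitz from the circle of length \<open>L\<close>:
  sides are isometric, the triangle inequality glues them at the corners \<open>a\<close> and
  \<open>b\<close>, and \<open>c L = c 0\<close> accounts for the arc through the starting
  point.\<close>

lemma geodesic_triangle_dist_le:
  assumes T: "geodesic_triangle M d c a b L"
    and tri: "\<And>x y z. x \<in> M \<Longrightarrow> y \<in> M \<Longrightarrow> z \<in> M \<Longrightarrow> d x z \<le> d x y + d y z"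
    and sym: "\<And>x y. d x y = d y x"
    and st: "s \<in> {0..L}" "t \<in> {0..L}"
  shows "d (c s) (c t) \<le> triangle_dist L s t"
proof -
  note bounds = geodesic_triangle_bounds[OF T]
  note C = geodesic_triangle_in_carrier[OF T]
  have side: "d (c s) (c t) \<le> t - s"
    if "(u, v) \<in> {(0, a), (a, b), (b, L)}" "u \<le> s" "s \<le> t" "t \<le> v" for u v s t
    using geodesic_triangle_side(1)[OF T that(1)] that(2-) by (auto simp: geodesic_on_def)
  have glue: "d (c s) (c t) \<le> t - s"
    if "0 \<le> s" "s \<le> r" "r \<le> t" "t \<le> L" "d (c s) (c r) \<le> r - s" "d (c r) (c t) \<le> t - r" for s r t
    using tri[of "c s" "c r" "c t"] C that by force
  have first_two: "d (c s) (c t) \<le> t - s" if "0 \<le> s" "s \<le> t" "t \<le> b" for s t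
  proof -
    consider "t \<le> a" | "a \<le> s" | "s \<le> a" "a \<le> t" by linarith
    then show ?thesis
      by cases (use that bounds side[of 0 a] side[of a b] in \<open>auto intro!: glue[of s a t]\<close>)
  qed
  have mono: "d (c s) (c t) \<le> t - s" if "0 \<le> s" "s \<le> t" "t \<le> L" for s t
  proof -
    consider "t \<le> b" | "b \<le> s" | "s \<le> b" "b \<le> t" by linarith
    then show ?thesis
      by cases (use that bounds side[of b L] first_two in \<open>auto intro!: glue[of s b t]\<close>)
  qed
  have ordered: "d (c s) (c t) \<le> triangle_dist L s t" if "0 \<le> s" "s \<le> t" "t \<le> L" for s t
  proof -
    \<comment> \<open>The detour from \<open>c s\<close> back to \<open>c 0 = c L\<close> and on to
      \<open>c t\<close> follows the other arc, of length \<open>L - (t - s)\<close>.\<close>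
    have "c 0 = c L" using T by (simp add: geodesic_triangle_def)
    then have "d (c s) (c t) \<le> d (c 0) (c s) + d (c t) (c L)"
      using tri[of "c s" "c 0" "c t"] C that sym by (simp add: sym)
    also have "\<dots> \<le> s + (L - t)" using mono[of 0 s] mono[of t L] that by simp
    finally show ?thesis using mono that by (simp add: triangle_dist_def)
  qed
  show ?thesis
    using ordered[of s t] ordered[of t s] st sym triangle_dist_commute
    by (metis atLeastAtMost_iff linear)
qed

text \<open>The other two sides form the closed arc complementary to the given one.\<close>

lemma thin_iff:
  assumes T: "geodesic_triangle M d c a b L"
  shows "thin d \<delta> c a b L \<longleftrightarrow>
    (\<forall>(u, v)\<in>{(0, a), (a, b), (b, L)}. \<forall>p\<in>{u..v}. \<exists>q\<in>{0..u} \<union> {v..L}. d (c p) (c q) \<le> \<delta>)"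
proof -
  note bounds = geodesic_triangle_bounds[OF T]
  have cL: "c L = c 0" using T by (simp add: geodesic_triangle_def)
  have "{a..b} \<union> {b..L} = {a..L}" "{0..a} \<union> {a..b} = {0..b}" using bounds by auto
  \<comment> \<open>For the first and the last side the complement formally contains a degenerate
    interval, \<open>{0..0}\<close> or \<open>{L..L}\<close>. It contributes only the point
    \<open>c 0 = c L\<close>, which the remaining interval already reaches.\<close>
  moreover have "c 0 \<in> c ` {a..L}" "c L \<in> c ` {0..b}"
    using bounds cL by (metis atLeastAtMost_iff imageI order.trans order.refl)+
  ultimately have "c ` {a..b} \<union> c ` {b..L} = c ` ({0..0} \<union> {a..L})"
    and "c ` {0..a} \<union> c ` {a..b} = c ` ({0..b} \<union> {L..L})"
    unfolding image_Un[symmetric] by (auto simp: image_Un)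
  moreover have "c ` {b..L} \<union> c ` {0..a} = c ` ({0..a} \<union> {b..L})" by auto
  ultimately show ?thesis
    by (simp add: thin_def in_nbhd_def bex_Un disj_commute)
qed

text \<open>Since \<open>6 * R \<le> L\<close>, some side has length at least \<open>2 * R\<close>.
  If the side of \<open>x\<close> does, moving \<open>x\<close> inwards by at most \<open>R\<close>
  suffices. Otherwise \<open>x\<close> is within \<open>2 * R\<close> of a corner shared with a long
  side, as any two sides are adjacent, and \<open>R\<close> further along that side gives
  \<open>p\<close>.\<close>

lemma point_far_from_corners:
  assumes ord: "0 \<le> a" "a \<le> b" "b \<le> L" and "6 * R \<le> L" "0 \<le> R" and x: "x \<in> {0..L}"
  shows "\<exists>(u, v)\<in>{(0, a), (a, b), (b, L)}. \<exists>p\<in>{u + R..v - R}. triangle_dist L p x \<le> 3 * R"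
proof -
  \<comment> \<open>The witness is the point of \<open>{u + R..v - R}\<close> nearest to
    \<open>x\<close>.\<close>
  have clamp: "\<exists>p\<in>{u + R..v - R}. triangle_dist L p x \<le> 3 * R"
    if "u \<le> x" "x \<le> v" "2 * R \<le> v - u" for u v
    using that assms
    by (intro bexI[of _ "max (u + R) (min x (v - R))"]) (auto simp: triangle_dist_def)
  have ex: ?thesis
    if "(u, v) \<in> {(0, a), (a, b), (b, L)}" "u + R \<le> p" "p \<le> v - R" "triangle_dist L p x \<le> 3 * R"
    for u v p
    using that by fastforce
  consider "x \<le> a" | "a \<le> x" "x \<le> b" | "b \<le> x" by linarith
  then show ?thesis
  proof cases
    case 1
    consider "2 * R \<le> a" | "a < 2 * R" "2 * R \<le> b - a" | "a < 2 * R" "2 * R \<le> L - b"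
      using assms by linarith
    then show ?thesis
    proof cases
      case 1 then show ?thesis using clamp[of 0 a] \<open>x \<le> a\<close> x by auto
    next
      case 2 then show ?thesis using \<open>x \<le> a\<close> x assms
        by (intro ex[of a b "a + R"]) (auto simp: triangle_dist_def)
    next
      \<comment> \<open>The sides \<open>[0, a]\<close> and \<open>[b, L]\<close> meet at the corner
        \<open>c 0 = c L\<close>, so the short arc from \<open>x\<close> to \<open>L - R\<close>
        wraps around and has length \<open>x + R\<close>.\<close>
      case 3 then show ?thesis using \<open>x \<le> a\<close> x assms
        by (intro ex[of b L "L - R"]) (auto simp: triangle_dist_def)
    qed
  next
    case xs: 2
    consider "2 * R \<le> b - a" | "b - a < 2 * R" "2 * R \<le> a" | "b - a < 2 * R" "2 * R \<le> L - b"
      using assms by linarith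
    then show ?thesis
    proof cases
      case 1 then show ?thesis using clamp[of a b] xs x by auto
    next
      case 2 then show ?thesis using xs x assms
        by (intro ex[of 0 a "a - R"]) (auto simp: triangle_dist_def)
    next
      case 3 then show ?thesis using xs x assms
        by (intro ex[of b L "b + R"]) (auto simp: triangle_dist_def)
    qed
  next
    case xs: 3
    consider "2 * R \<le> L - b" | "L - b < 2 * R" "2 * R \<le> a" | "L - b < 2 * R" "2 * R \<le> b - a"
      using assms by linarith
    then show ?thesis
    proof cases
      case 1 then show ?thesis using clamp[of b L] xs x by auto
    next
      case 2 then show ?thesis using xs x assms
        by (intro ex[of 0 a R]) (auto simp: triangle_dist_def)
    next
      case 3 then show ?thesis using xs x assms
        by (intro ex[of a b "b - R"]) (auto simp: triangle_dist_def)
    qed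
  qed
qed

subsection \<open>Hyperbolicity and shortcuts\<close>

lemma hyperbolic_shortcut_near:
  assumes mg: "metric_graph G l" and con: "Digraph_Component.connected G"
    and hyp: "hyperbolic (points G l) (graph_dist G l) \<delta>" and "0 \<le> \<delta>"
    and T: "geodesic_triangle (points G l) (graph_dist G l) c a b L"
    and L: "6 * (\<delta> + 1) \<le> L" and x: "x \<in> {0..L}"
  shows "\<exists>p \<sigma> q. shortcut G l c L p \<sigma> q \<and> path_length \<sigma> \<le> \<delta> + 1 \<and>
    triangle_dist L p x \<le> 3 * (\<delta> + 1)"
proof -
  obtain u v p where uv: "(u, v) \<in> {(0, a), (a, b), (b, L)}"
    and p: "p \<in> {u + (\<delta> + 1)..v - (\<delta> + 1)}" "triangle_dist L p x \<le> 3 * (\<delta> + 1)"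
    using point_far_from_corners[OF geodesic_triangle_bounds[OF T] L _ x] \<open>0 \<le> \<delta>\<close> by fastforce
  note side = geodesic_triangle_side[OF T uv]
  have "p \<in> {u..v}" using p \<open>0 \<le> \<delta>\<close> by auto
  moreover have "thin (graph_dist G l) \<delta> c a b L" using hyp T by (simp add: hyperbolic_def)
  ultimately obtain q where q: "q \<in> {0..u} \<union> {v..L}" "graph_dist G l (c p) (c q) \<le> \<delta>"
    using uv unfolding thin_iff[OF T] by blast
  have pq: "p \<in> {0..L}" "q \<in> {0..L}" using p q side \<open>0 \<le> \<delta>\<close> by auto
  \<comment> \<open>As \<open>q\<close> is not strictly between \<open>u\<close> and
    \<open>v\<close>, each of the two arcs from \<open>p\<close> to \<open>q\<close> passes
    \<open>u\<close> or \<open>v\<close>, and \<open>p\<close> is at least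
    \<open>\<delta> + 1\<close> away from both.\<close>
  have far: "\<delta> + 1 \<le> triangle_dist L p q"
    using p q side by (auto simp: triangle_dist_def)
  \<comment> \<open>The extra 1 in the margin pays for the strict inequality: a path of length
    exactly \<open>\<delta>\<close> need not exist.\<close>
  obtain \<sigma> where \<sigma>: "joins G l (c p) \<sigma> (c q)" "path_length \<sigma> < \<delta> + 1"
    using graph_dist_less_path[OF mg con, of "c p" "c q" "\<delta> + 1"] q(2)
      geodesic_triangle_in_carrier[OF T] pq by fastforce
  have "shortcut G l c L p \<sigma> q" using pq \<sigma> far by (simp add: shortcut_def)
  with \<sigma>(2) p(2) show ?thesis by (intro exI conjI) auto
qed

lemma hyperbolic_imp_densely_path_chordal:
  assumes "metric_graph G l" "Digraph_Component.connected G"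
    and "hyperbolic (points G l) (graph_dist G l) \<delta>" "0 \<le> \<delta>"
  shows "densely_path_chordal_on_triangles G l (3 * (\<delta> + 1) + 2) (6 * (\<delta> + 1)) (\<delta> + 1)"
  unfolding densely_path_chordal_on_triangles_def
proof (intro allI impI, elim conjE)
  fix c a b L
  assume T: "geodesic_triangle (points G l) (graph_dist G l) c a b L" and L: "6 * (\<delta> + 1) \<le> L"
  \<comment> \<open>Only finitely many shortcuts are allowed, so one is chosen for each integer
    parameter instead of for each point.\<close>
  define N where "N = real ` {i. real i \<le> L}"
  have "N \<subseteq> {0..L}" by (auto simp: N_def)
  have "{i. real i \<le> L} \<subseteq> {..nat \<lfloor>L\<rfloor>}" by (auto simp: le_nat_iff le_floor_iff)
  then have "finite N" unfolding N_def using finite_subset by blast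
  have "\<forall>x\<in>N. \<exists>p \<sigma> q. shortcut G l c L p \<sigma> q \<and> path_length \<sigma> \<le> \<delta> + 1 \<and>
      triangle_dist L p x \<le> 3 * (\<delta> + 1)"
    using hyperbolic_shortcut_near[OF assms T L] \<open>N \<subseteq> {0..L}\<close> by blast
  then obtain P \<Sigma> Q where PQ: "\<And>x. x \<in> N \<Longrightarrow> shortcut G l c L (P x) (\<Sigma> x) (Q x)"
      "\<And>x. x \<in> N \<Longrightarrow> path_length (\<Sigma> x) \<le> \<delta> + 1"
      "\<And>x. x \<in> N \<Longrightarrow> triangle_dist L (P x) x \<le> 3 * (\<delta> + 1)"
    by metis
  define S where "S = (\<lambda>x. (P x, \<Sigma> x, Q x)) ` N"
  have "eps_dense {0..L} (triangle_dist L) (3 * (\<delta> + 1) + 2) (\<Union>(p, \<sigma>, q)\<in>S. {p, q})"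
    unfolding eps_dense_def
  proof (intro conjI ballI)
    show "(\<Union>(p, \<sigma>, q)\<in>S. {p, q}) \<subseteq> {0..L}"
      using PQ(1) by (fastforce simp: S_def shortcut_def)
  next
    fix x assume x: "x \<in> {0..L}"
    \<comment> \<open>Rounding down moves \<open>x\<close> by less than 1, which the summand 2 in
      the density constant absorbs.\<close>
    define n where "n = real (nat \<lfloor>x\<rfloor>)"
    have n: "n \<le> x" "x < n + 1" using x unfolding n_def by auto
    then have "n \<in> N" using x unfolding N_def n_def by (intro imageI) auto
    have "triangle_dist L (P n) x < 3 * (\<delta> + 1) + 2"
      using PQ(3)[OF \<open>n \<in> N\<close>] n by (auto simp: triangle_dist_def)
    moreover have "P n \<in> (\<Union>(p, \<sigma>, q)\<in>S. {p, q})" using \<open>n \<in> N\<close> by (auto simp: S_def)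
    ultimately show "\<exists>y\<in>\<Union>(p, \<sigma>, q)\<in>S. {p, q}. triangle_dist L y x < 3 * (\<delta> + 1) + 2"
      by blast
  qed
  moreover have "finite S" using \<open>finite N\<close> by (simp add: S_def)
  moreover have "\<forall>(p, \<sigma>, q)\<in>S. shortcut G l c L p \<sigma> q \<and> path_length \<sigma> \<le> \<delta> + 1"
    using PQ by (auto simp: S_def)
  ultimately show "\<exists>S. finite S \<and>
      (\<forall>(p, \<sigma>, q)\<in>S. shortcut G l c L p \<sigma> q \<and> path_length \<sigma> \<le> \<delta> + 1) \<and>
      eps_dense {0..L} (triangle_dist L) (3 * (\<delta> + 1) + 2) (\<Union>(p, \<sigma>, q)\<in>S. {p, q})"
    by blast
qed

section \<open>From dense shortcuts to thin triangles\<close>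

lemma shortcut_leaves_side:
  assumes T: "geodesic_triangle (points G l) (graph_dist G l) c a b L"
    and uv: "(u, v) \<in> {(0, a), (a, b), (b, L)}"
    and sc: "shortcut G l c L p \<sigma> q"
  shows "p \<notin> {u..v} \<or> q \<notin> {u..v}"
proof (rule ccontr)
  assume "\<not> ?thesis"
  then have "graph_dist G l (c p) (c q) = \<bar>p - q\<bar>"
    using geodesic_triangle_side(1)[OF T uv] by (auto simp: geodesic_on_def)
  moreover have "graph_dist G l (c p) (c q) < triangle_dist L p q"
    using sc graph_dist_le_path_length by (fastforce simp: shortcut_def)
  ultimately show False by (simp add: triangle_dist_def)
qed

text \<open>In the constant, \<open>k\<close> covers triangles shorter than \<open>k\<close>, whose
  sides are themselves short. In longer ones, \<open>\<epsilon>\<close> is the cost of reaching a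
  shortcut vertex and \<open>m\<close> that of crossing the shortcut.\<close>

lemma densely_path_chordal_imp_hyperbolic:
  assumes mg: "metric_graph G l" and con: "Digraph_Component.connected G"
    and chordal: "densely_path_chordal_on_triangles G l \<epsilon> k m"
    and nonneg: "0 < \<epsilon>" "0 \<le> k" "0 \<le> m"
  shows "hyperbolic (points G l) (graph_dist G l) (\<epsilon> + k + m)"
  unfolding hyperbolic_def
proof (intro allI impI)
  fix c a b L
  assume T: "geodesic_triangle (points G l) (graph_dist G l) c a b L"
  note C = geodesic_triangle_in_carrier[OF T]
  have dist_le: "graph_dist G l (c s) (c t) \<le> triangle_dist L s t"
    if "s \<in> {0..L}" "t \<in> {0..L}" for s t
    by (rule geodesic_triangle_dist_le[OF T _ graph_dist_commute[OF mg] that])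
      (rule graph_dist_triangle[OF mg con])
  have "\<exists>q\<in>{0..u} \<union> {v..L}. graph_dist G l (c x) (c q) \<le> \<epsilon> + k + m"
    if uv: "(u, v) \<in> {(0, a), (a, b), (b, L)}" and x: "x \<in> {u..v}" for u v x
  proof -
    note side = geodesic_triangle_side[OF T uv]
    have xL: "x \<in> {0..L}" using x side by auto
    show ?thesis
    proof (cases "k \<le> L")
      case False
      \<comment> \<open>The corner \<open>u\<close> belongs to the complementary arc and lies on the
        side of \<open>x\<close>, whose length is at most \<open>L < k\<close>.\<close>
      have "graph_dist G l (c x) (c u) = \<bar>x - u\<bar>"
        using side x by (auto simp: geodesic_on_def)
      with False x side nonneg show ?thesis by (intro bexI[of _ u]) auto
    next
      case True
      then obtain S
        where S: "\<forall>(p, \<sigma>, q)\<in>S. shortcut G l c L p \<sigma> q \<and> path_length \<sigma> \<le> m"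
          and dense: "eps_dense {0..L} (triangle_dist L) \<epsilon> (\<Union>(p, \<sigma>, q)\<in>S. {p, q})"
        using chordal[unfolded densely_path_chordal_on_triangles_def, rule_format, OF conjI[OF T]]
        by auto
      obtain y where y: "y \<in> (\<Union>(p, \<sigma>, q)\<in>S. {p, q})" "triangle_dist L y x < \<epsilon>"
        using dense xL unfolding eps_dense_def by blast
      then obtain p \<sigma> q where pq: "(p, \<sigma>, q) \<in> S" "y = p \<or> y = q" by auto
      with S have sc: "shortcut G l c L p \<sigma> q" "path_length \<sigma> \<le> m" by auto
      then have "graph_dist G l (c p) (c q) \<le> m"
        using graph_dist_le_path_length by (fastforce simp: shortcut_def)
      \<comment> \<open>\<open>z\<close> is the end of the shortcut opposite to the nearby end
        \<open>y\<close>.\<close>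
      moreover define z where "z = (if y = p then q else p)"
      ultimately have yz: "graph_dist G l (c y) (c z) \<le> m"
        using pq(2) graph_dist_commute[OF mg] by auto
      have L: "y \<in> {0..L}" "z \<in> {0..L}"
        using sc(1) pq(2) by (auto simp: shortcut_def z_def)
      have xy: "graph_dist G l (c x) (c y) < \<epsilon>"
        using dist_le[OF xL L(1)] y(2) by (simp add: triangle_dist_commute)
      have "graph_dist G l (c x) (c z) \<le> \<epsilon> + m"
        using graph_dist_triangle[OF mg con C[OF xL] C[OF L(1)] C[OF L(2)]] xy yz by simp
      \<comment> \<open>Whichever end lies off the side serves as \<open>q\<close>: \<open>y\<close>
        is within \<open>\<epsilon>\<close> of \<open>x\<close>, and \<open>z\<close> within
        \<open>\<epsilon> + m\<close>.\<close>
      moreover have "y \<notin> {u..v} \<or> z \<notin> {u..v}"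
        using shortcut_leaves_side[OF T uv sc(1)] pq(2) by (auto simp: z_def)
      ultimately show ?thesis
        using L xy nonneg
        by (elim disjE; intro bexI[of _ "if y \<notin> {u..v} then y else z"]) auto
    qed
  qed
  then show "thin (graph_dist G l) (\<epsilon> + k + m) c a b L"
    unfolding thin_iff[OF T] by blast
qed

theorem theorem3p2:
  fixes G :: "('v, 'e) pre_digraph" and l :: "'e \<Rightarrow> real"
  assumes "metric_graph G l"
    and "Digraph_Component.connected G"
    and "locally_finite G"
  shows "(\<exists>\<delta>\<ge>0. hyperbolic (points G l) (graph_dist G l) \<delta>) \<longleftrightarrow>
         (\<exists>\<epsilon>>0. \<exists>k\<ge>0. \<exists>m\<ge>0. densely_path_chordal_on_triangles G l \<epsilon> k m)"
proof
  assume "\<exists>\<delta>\<ge>0. hyperbolic (points G l) (graph_dist G l) \<delta>"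
  then obtain \<delta> where \<delta>: "0 \<le> \<delta>" "hyperbolic (points G l) (graph_dist G l) \<delta>" by blast
  then have "0 < 3 * (\<delta> + 1) + 2" "0 \<le> 6 * (\<delta> + 1)" "0 \<le> \<delta> + 1" by auto
  with hyperbolic_imp_densely_path_chordal[OF assms(1,2) \<delta>(2,1)]
  show "\<exists>\<epsilon>>0. \<exists>k\<ge>0. \<exists>m\<ge>0. densely_path_chordal_on_triangles G l \<epsilon> k m" by blast
next
  assume "\<exists>\<epsilon>>0. \<exists>k\<ge>0. \<exists>m\<ge>0. densely_path_chordal_on_triangles G l \<epsilon> k m"
  then obtain \<epsilon> k m where *: "0 < \<epsilon>" "0 \<le> k" "0 \<le> m"
    and "densely_path_chordal_on_triangles G l \<epsilon> k m" by blast
  then have "hyperbolic (points G l) (graph_dist G l) (\<epsilon> + k + m)"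
    using densely_path_chordal_imp_hyperbolic[OF assms(1,2)] by blast
  with * show "\<exists>\<delta>\<ge>0. hyperbolic (points G l) (graph_dist G l) \<delta>"
    by (intro exI[of _ "\<epsilon> + k + m"]) auto
qed

end
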